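(* Let $k\ge 1$ be an integer and let $G$ be a connected graph of order $n\ge 13k^2-11k-1$ with minimum degree $\delta(G)\ge k$. If $e(G)>\binom{n-k-1}{2}+k(k+1)+k-1$, then $G$ contains a $k$-factor.
   Context: All graphs are finite, simple and undirected. $e(G)$ denotes the number of edges of $G$. A $k$-factor of $G$ is a $k$-regular spanning subgraph of $G$.
   Formalization: The formal statement additionally assumes that kn is even (otherwise no k-factor exists, e.g. K_3 with k=1) and excludes k=1 with n=6 or n=8, where K_2 join 4K_1 and K_3 join 5K_1 are counterexamples. *)

theory Defs
  imports Complex_Main
begin

definition simple_graph :: "'a set \<Rightarrow> 'a set set \<Rightarrow> bool" where
  "simple_graph V E \<longleftrightarrow> finite V \<and> (\<forall>e\<in>E. e \<subseteq> V \<and> card e = 2)"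

definition vertex_degree :: "'a set set \<Rightarrow> 'a \<Rightarrow> nat" where
  "vertex_degree E v = card {e \<in> E. v \<in> e}"

(* Only meaningful for a finite nonempty vertex set. *)
definition min_degree :: "'a set \<Rightarrow> 'a set set \<Rightarrow> nat" where
  "min_degree V E = Min (vertex_degree E ` V)"

(* The null graph is not connected. *)
definition connected_graph :: "'a set \<Rightarrow> 'a set set \<Rightarrow> bool" where
  "connected_graph V E \<longleftrightarrow>
     V \<noteq> {} \<and> (\<forall>u\<in>V. \<forall>v\<in>V. (u, v) \<in> {(x, y). {x, y} \<in> E}\<^sup>*)"

definition regular_graph :: "nat \<Rightarrow> 'a set \<Rightarrow> 'a set set \<Rightarrow> bool" where
  "regular_graph k V E \<longleftrightarrow> (\<forall>v\<in>V. vertex_degree E v = k)"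

(* A spanning subgraph of (V, E) has vertex set V, so it is given by its edge set F. *)
definition is_k_factor :: "nat \<Rightarrow> 'a set \<Rightarrow> 'a set set \<Rightarrow> 'a set set \<Rightarrow> bool" where
  "is_k_factor k V E F \<longleftrightarrow> F \<subseteq> E \<and> regular_graph k V F"

end

theory Submission
  imports Defs
begin

text \<open>
  Take a subgraph \<open>F\<close> with all degrees at most \<open>k\<close>. If every vertex of \<open>F\<close>-degree below \<open>k\<close>
  has degree at least \<open>(n + 2k - 2) / 2\<close> in the graph, then a counting argument in the spirit of the
  Bondy--Chvatal closure gives deficient \<open>u, v\<close> and an edge \<open>xy\<close> of \<open>F\<close> that can be traded for
  \<open>ux\<close> and \<open>vy\<close>; so \<open>F\<close> grows to a \<open>k\<close>-factor. It remains to saturate the set \<open>L\<close> of vertices of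
  smaller degree. Let \<open>H\<close> consist of the vertices of \<open>L\<close> with fewer than \<open>k + |L| - 1\<close> neighbours
  outside \<open>L\<close>. The edge bound forces \<open>|H| \<le> k + 1\<close>. On \<open>H\<close> one takes all inner edges and chooses
  the remaining ones; when \<open>|H| = k + 1\<close> the edge bound leaves \<open>k\<close> surplus edges, enough to keep
  every outside vertex from being chosen \<open>k + 1\<close> times. The rest of \<open>L\<close> is then saturated greedily by
  edges leaving \<open>L\<close>, since at most as many outside vertices are full as vertices have been treated.
\<close>

section \<open>Neighbourhoods and degrees\<close>

definition nbrs :: "'a set set \<Rightarrow> 'a \<Rightarrow> 'a set" where
  "nbrs F v = {w. {v, w} \<in> F}"

lemma nbrs_sym: "w \<in> nbrs F v \<longleftrightarrow> v \<in> nbrs F w"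
  by (simp add: nbrs_def insert_commute)

lemma simple_graph_subset: "simple_graph V E \<Longrightarrow> F \<subseteq> E \<Longrightarrow> simple_graph V F"
  by (auto simp: simple_graph_def)

lemma simple_graph_finite:
  assumes "simple_graph V E"
  shows "finite V" "finite E"
proof -
  show "finite V" using assms by (simp add: simple_graph_def)
  moreover have "E \<subseteq> Pow V" using assms by (auto simp: simple_graph_def)
  ultimately show "finite E" using finite_subset by blast
qed

lemma simple_graph_nbrs:
  assumes "simple_graph V E"
  shows "nbrs E v \<subseteq> V" "v \<notin> nbrs E v" "finite (nbrs E v)"
proof -
  show 1: "nbrs E v \<subseteq> V" using assms by (auto simp: simple_graph_def nbrs_def)
  show "v \<notin> nbrs E v"
  proof
    assume "v \<in> nbrs E v"
    then have "card {v, v} = 2" using assms unfolding simple_graph_def nbrs_def by blast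
    then show False by simp
  qed
  show "finite (nbrs E v)" using 1 simple_graph_finite(1)[OF assms] finite_subset by blast
qed

lemma simple_graph_edgeE:
  assumes "simple_graph V E" "e \<in> E" "v \<in> e"
  obtains w where "e = {v, w}" "w \<in> V" "v \<in> V" "w \<noteq> v"
proof -
  have "card e = 2" "e \<subseteq> V" using assms by (auto simp: simple_graph_def)
  then obtain a b where "e = {a, b}" "a \<noteq> b" by (auto simp: card_2_iff)
  with \<open>v \<in> e\<close> \<open>e \<subseteq> V\<close> show ?thesis
    using that by (metis insert_commute insert_iff insert_subset singletonD)
qed

lemma vertex_degree_nbrs:
  assumes "simple_graph V E"
  shows "vertex_degree E v = card (nbrs E v)"
proof -
  have "e \<in> (\<lambda>w. {v, w}) ` nbrs E v" if "e \<in> E" "v \<in> e" for e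
    using simple_graph_edgeE[OF assms that] that unfolding nbrs_def by blast
  then have "{e \<in> E. v \<in> e} = (\<lambda>w. {v, w}) ` nbrs E v"
    by (auto simp: nbrs_def)
  moreover have "inj_on (\<lambda>w. {v, w}) (nbrs E v)"
    by (auto simp: inj_on_def doubleton_eq_iff)
  ultimately show ?thesis by (simp add: vertex_degree_def card_image)
qed

section \<open>Double counting of edges\<close>

lemma sum_vertex_degree:
  assumes "simple_graph V E"
  shows "(\<Sum>v\<in>V. vertex_degree E v) = 2 * card E"
proof -
  have "card {v \<in> V. v \<in> e} = 2" if "e \<in> E" for e
  proof -
    have "{v \<in> V. v \<in> e} = e" using assms that by (auto simp: simple_graph_def)
    then show ?thesis using assms that by (auto simp: simple_graph_def)
  qed
  then show ?thesis
    unfolding vertex_degree_def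
    using sum_multicount[of V E "\<lambda>v e. v \<in> e" 2] simple_graph_finite[OF assms] by simp
qed

lemma sum_card_nbrs_swap:
  assumes "finite A" "finite B"
  shows "(\<Sum>a\<in>A. card (nbrs F a \<inter> B)) = (\<Sum>b\<in>B. card (nbrs F b \<inter> A))"
proof -
  have *: "card (X \<inter> B) = (\<Sum>b\<in>B. if b \<in> X then 1 else 0)" if "finite B" for X B :: "'a set"
    using that by (simp add: sum.If_cases Int_commute)
  have "(\<Sum>a\<in>A. card (nbrs F a \<inter> B)) = (\<Sum>a\<in>A. \<Sum>b\<in>B. if b \<in> nbrs F a then 1 else 0)"
    using * assms by simp
  also have "\<dots> = (\<Sum>b\<in>B. \<Sum>a\<in>A. if a \<in> nbrs F b then 1 else 0)"
    by (subst sum.swap) (simp add: nbrs_sym)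
  also have "\<dots> = (\<Sum>b\<in>B. card (nbrs F b \<inter> A))"
    using * assms by simp
  finally show ?thesis .
qed

text \<open>A vertex outside \<open>T\<close> has at most \<open>card (V - T) - 1\<close> neighbours
  outside \<open>T\<close>, and its edges into \<open>T\<close> are counted from the other end by
  \<open>card (nbrs E v - T)\<close>. The edge bound of the theorem is always exploited through this
  inequality, for various \<open>T\<close>; doubling and integers avoid division and truncated
  subtraction.\<close>

lemma twice_card_edges_le:
  assumes G: "simple_graph V E" and T: "T \<subseteq> V"
  shows "2 * int (card E) \<le> (int (card V) - int (card T)) * (int (card V) - int (card T) - 1)
           + (\<Sum>v\<in>T. int (vertex_degree E v) + int (card (nbrs E v - T)))"
proof -
  note fV = simple_graph_finite(1)[OF G]
  have fT: "finite T" using T fV finite_subset by blast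
  have c: "int (card (V - T)) = int (card V) - int (card T)"
    using T fT fV by (simp add: card_Diff_subset card_mono of_nat_diff)
  have "int (vertex_degree E v) \<le> int (card (nbrs E v \<inter> T)) + (int (card (V - T)) - 1)"
    if v: "v \<in> V - T" for v
  proof -
    have "card (nbrs E v) = card (nbrs E v \<inter> T) + card (nbrs E v - T)"
      using simple_graph_nbrs(3)[OF G] by (metis card_Int_Diff)
    moreover have "card (nbrs E v - T) \<le> card (V - T - {v})"
      using simple_graph_nbrs[OF G, of v] fV by (intro card_mono) auto
    moreover have "card (V - T - {v}) + 1 = card (V - T)"
      using v fV by (metis Suc_eq_plus1 card_Suc_Diff1 finite_Diff)
    ultimately show ?thesis using vertex_degree_nbrs[OF G] by simp
  qed
  then have "(\<Sum>v\<in>V-T. int (vertex_degree E v))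
      \<le> (\<Sum>v\<in>V-T. int (card (nbrs E v \<inter> T)) + (int (card (V - T)) - 1))"
    by (rule sum_mono)
  also have "\<dots> = int (\<Sum>v\<in>V-T. card (nbrs E v \<inter> T)) + int (card (V - T)) * (int (card (V - T)) - 1)"
    by (simp add: sum.distrib)
  also have "(\<Sum>v\<in>V-T. card (nbrs E v \<inter> T)) = (\<Sum>v\<in>T. card (nbrs E v \<inter> (V - T)))"
    using sum_card_nbrs_swap fT fV by blast
  also have "\<dots> = (\<Sum>v\<in>T. card (nbrs E v - T))"
  proof (rule sum.cong[OF refl])
    fix v
    have "nbrs E v \<inter> (V - T) = nbrs E v - T" using simple_graph_nbrs(1)[OF G, of v] by blast
    then show "card (nbrs E v \<inter> (V - T)) = card (nbrs E v - T)" by simp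
  qed
  finally have "(\<Sum>v\<in>V-T. int (vertex_degree E v))
      \<le> int (\<Sum>v\<in>T. card (nbrs E v - T)) + int (card (V - T)) * (int (card (V - T)) - 1)" .
  moreover have "2 * int (card E) = (\<Sum>v\<in>V. int (vertex_degree E v))"
    using sum_vertex_degree[OF G] by (metis of_nat_mult of_nat_numeral of_nat_sum)
  moreover have "\<dots> = (\<Sum>v\<in>V-T. int (vertex_degree E v)) + (\<Sum>v\<in>T. int (vertex_degree E v))"
    using sum.subset_diff[OF T fV] by blast
  ultimately show ?thesis using c by (simp add: sum.distrib)
qed

section \<open>Growing a degree-bounded subgraph into a k-factor\<close>

lemma vertex_degree_insert:
  assumes "finite F" "e \<notin> F"
  shows "vertex_degree (insert e F) v = vertex_degree F v + (if v \<in> e then 1 else 0)"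
proof -
  have "{e' \<in> insert e F. v \<in> e'} = (if v \<in> e then insert e {e' \<in> F. v \<in> e'} else {e' \<in> F. v \<in> e'})"
    by auto
  then show ?thesis using assms by (simp add: vertex_degree_def)
qed

lemma vertex_degree_remove:
  assumes "finite F" "e \<in> F"
  shows "vertex_degree F v = vertex_degree (F - {e}) v + (if v \<in> e then 1 else 0)"
  using vertex_degree_insert[of "F - {e}" e v] assms by (simp add: insert_absorb)

lemma augment_deficient_pair:
  assumes G: "simple_graph V E" and FE: "F \<subseteq> E"
    and le: "\<And>v. v \<in> V \<Longrightarrow> vertex_degree F v \<le> k"
    and uv: "u \<in> V" "v \<in> V" "vertex_degree F u < k" "vertex_degree F v < k"
    and same: "u = v \<Longrightarrow> vertex_degree F u + 2 \<le> k"
    and big: "card V + 2 * k \<le> vertex_degree E u + vertex_degree E v + 2"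
  obtains F' where "F' \<subseteq> E" "card F < card F'"
    "\<And>w. w \<in> V \<Longrightarrow> vertex_degree F w \<le> vertex_degree F' w \<and> vertex_degree F' w \<le> k"
proof -
  note fV = simple_graph_finite(1)[OF G]
  note GF = simple_graph_subset[OF G FE]
  have fF: "finite F" using simple_graph_finite(2)[OF GF] .
  show ?thesis
  proof (cases "\<exists>a\<in>V. \<exists>b\<in>V. vertex_degree F a < k \<and> vertex_degree F b < k \<and> {a, b} \<in> E - F")
    case True
    then obtain a b where ab: "a \<in> V" "b \<in> V" "vertex_degree F a < k" "vertex_degree F b < k"
      "{a, b} \<in> E" "{a, b} \<notin> F" by blast
    show ?thesis
    proof (rule that)
      show "insert {a, b} F \<subseteq> E" using FE ab by auto
      show "card F < card (insert {a, b} F)" using ab fF by simp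
      fix w assume "w \<in> V"
      then show "vertex_degree F w \<le> vertex_degree (insert {a, b} F) w
          \<and> vertex_degree (insert {a, b} F) w \<le> k"
        using ab le[of w] by (auto simp: vertex_degree_insert[OF fF ab(6)])
    qed
  next
    case False
    define A where "A = nbrs (E - F) u"
    define B where "B = nbrs (E - F) v"
    have GD: "simple_graph V (E - F)" using G simple_graph_subset by blast
    have sub: "A \<subseteq> V" "B \<subseteq> V" using simple_graph_nbrs[OF GD] unfolding A_def B_def by auto
    have fA: "finite A" "finite B" using sub fV finite_subset by auto
    have Asat: "vertex_degree F x = k" if "x \<in> A \<union> B" for x
    proof -
      have "x \<in> V" using sub that by blast
      moreover have "\<not> vertex_degree F x < k"
        using False uv that \<open>x \<in> V\<close> unfolding A_def B_def nbrs_def by blast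
      ultimately show ?thesis using le[of x] by simp
    qed
    have cardD: "vertex_degree E x = card (nbrs (E - F) x) + vertex_degree F x" for x
    proof -
      have "nbrs E x = nbrs (E - F) x \<union> nbrs F x" "nbrs (E - F) x \<inter> nbrs F x = {}"
        using FE by (auto simp: nbrs_def)
      then show ?thesis using vertex_degree_nbrs[OF G] vertex_degree_nbrs[OF GF]
          simple_graph_nbrs(3)[OF GD] simple_graph_nbrs(3)[OF GF] by (simp add: card_Un_disjoint)
    qed
    \<comment> \<open>As \<open>u\<close> and \<open>v\<close> are deficient, \<open>big\<close>
      gives \<open>card A + card B >= card V\<close>. Without an \<open>F\<close>-edge between
      \<open>A\<close> and \<open>B\<close>, the \<open>k * card A\<close> edge ends at the
      saturated set \<open>A\<close> would all lead into \<open>V - B\<close>, which cannot absorb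
      them.\<close>
    have "\<exists>x\<in>A. \<exists>y\<in>B. {x, y} \<in> F"
    proof (rule ccontr)
      assume none: "\<not> ?thesis"
      have "k * card A = (\<Sum>x\<in>A. card (nbrs F x \<inter> (V - B)))"
      proof -
        have "card (nbrs F x \<inter> (V - B)) = k" if "x \<in> A" for x
        proof -
          have "nbrs F x \<inter> (V - B) = nbrs F x"
            using none that simple_graph_nbrs(1)[OF GF, of x] by (auto simp: nbrs_def)
          then show ?thesis using Asat that vertex_degree_nbrs[OF GF] by simp
        qed
        then show ?thesis by simp
      qed
      also have "\<dots> = (\<Sum>y\<in>V - B. card (nbrs F y \<inter> A))"
        using fA fV by (intro sum_card_nbrs_swap) auto
      \<comment> \<open>Strict because \<open>u\<close> lies in \<open>V - B\<close> and has
        \<open>F\<close>-degree below \<open>k\<close>.\<close>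
      also have "\<dots> < (\<Sum>y\<in>V - B. k)"
      proof (rule sum_strict_mono_ex1)
        have ley: "card (nbrs F y \<inter> A) \<le> vertex_degree F y" for y
          using simple_graph_nbrs(3)[OF GF] vertex_degree_nbrs[OF GF] by (simp add: card_mono)
        show "\<forall>y\<in>V - B. card (nbrs F y \<inter> A) \<le> k"
          using ley le by (meson DiffD1 le_trans)
        have "u \<in> V - B" using Asat uv by blast
        then show "\<exists>y\<in>V - B. card (nbrs F y \<inter> A) < k"
          using ley[of u] uv by (meson le_less_trans)
      qed (use fV in auto)
      also have "\<dots> = k * card (V - B)" by simp
      finally have "card A < card (V - B)" by simp
      moreover have "card (V - B) = card V - card B" using sub fA by (simp add: card_Diff_subset)
      ultimately show False using cardD[of u] cardD[of v] uv big unfolding A_def B_def by linarith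
    qed
    then obtain x y where x: "x \<in> A" and y: "y \<in> B" and xy: "{x, y} \<in> F" by blast
    have ne: "x \<noteq> u" "x \<noteq> v" "y \<noteq> u" "y \<noteq> v"
      using Asat[of x] Asat[of y] x y uv by auto
    have "x \<noteq> y" using xy simple_graph_nbrs(2)[OF GF, of x] by (auto simp: nbrs_def)
    have ux: "{u, x} \<in> E" "{u, x} \<notin> F" and vy: "{v, y} \<in> E" "{v, y} \<notin> F"
      using x y by (auto simp: A_def B_def nbrs_def)
    define F0 where "F0 = F - {{x, y}}"
    define F' where "F' = insert {u, x} (insert {v, y} F0)"
    have f0: "finite F0" using fF by (simp add: F0_def)
    have n1: "{v, y} \<notin> F0" using vy by (simp add: F0_def)
    have n2: "{u, x} \<notin> insert {v, y} F0"
      using ux ne \<open>x \<noteq> y\<close> by (auto simp: F0_def doubleton_eq_iff)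
    \<comment> \<open>Stated as a balance, so that nothing is subtracted; it covers
      \<open>u = v\<close> as well.\<close>
    have deg: "vertex_degree F' w + (if w \<in> {x, y} then 1 else 0)
        = vertex_degree F w + (if w \<in> {v, y} then 1 else 0) + (if w \<in> {u, x} then 1 else 0)" for w
      unfolding F'_def
      using vertex_degree_remove[OF fF xy, of w, folded F0_def]
      by (simp add: vertex_degree_insert[OF _ n2] vertex_degree_insert[OF f0 n1] f0)
    show ?thesis
    proof (rule that)
      show "F' \<subseteq> E" using FE ux vy by (auto simp: F'_def F0_def)
      have "card F0 + 1 = card F" using fF xy unfolding F0_def
        by (metis Suc_eq_plus1 card_Suc_Diff1)
      then show "card F < card F'" unfolding F'_def using n1 n2 f0 by simp
      fix w assume "w \<in> V"
      then show "vertex_degree F w \<le> vertex_degree F' w \<and> vertex_degree F' w \<le> k"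
        using deg[of w] le[of w] uv same ne \<open>x \<noteq> y\<close> by (auto split: if_splits)
    qed
  qed
qed

text \<open>Augmentation never lowers a degree of \<open>F\<close>, so no new deficient vertices
  arise and the degree condition on them persists; \<open>card E\<close> bounds the number of
  rounds.\<close>

lemma k_factor_completion:
  assumes G: "simple_graph V E" and ev: "even (k * card V)"
    and "F \<subseteq> E"
    and "\<And>v. v \<in> V \<Longrightarrow> vertex_degree F v \<le> k"
    and "\<And>v. v \<in> V \<Longrightarrow> vertex_degree F v < k \<Longrightarrow> card V + 2 * k \<le> 2 * vertex_degree E v + 2"
  shows "\<exists>F. is_k_factor k V E F"
  using assms(3-)
proof (induction "card E - card F" arbitrary: F rule: less_induct)
  case less
  note fV = simple_graph_finite(1)[OF G]
  note GF = simple_graph_subset[OF G less.prems(1)]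
  show ?case
  proof (cases "\<forall>v\<in>V. vertex_degree F v = k")
    case True
    then show ?thesis using less.prems(1) by (auto simp: is_k_factor_def regular_graph_def)
  next
    case False
    then obtain u where u: "u \<in> V" "vertex_degree F u < k"
      using less.prems(2) by (meson nat_neq_iff not_less)
    \<comment> \<open>Parity: a sole deficient vertex lacking exactly one edge would make the degree
      sum \<open>k * card V - 1\<close>, an odd number.\<close>
    have "\<exists>v\<in>V. vertex_degree F v < k \<and> (u = v \<longrightarrow> vertex_degree F u + 2 \<le> k)"
    proof (rule ccontr)
      assume H: "\<not> ?thesis"
      then have "\<not> vertex_degree F u + 2 \<le> k" using u by blast
      then have 1: "vertex_degree F u + 1 = k" using u by linarith
      have "vertex_degree F v = k" if "v \<in> V - {u}" for v
      proof -
        have "\<not> vertex_degree F v < k" using H that by blast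
        then show ?thesis using less.prems(2)[of v] that by auto
      qed
      then have "(\<Sum>v\<in>V. vertex_degree F v) = vertex_degree F u + k * card (V - {u})"
        using fV u by (simp add: sum.remove)
      then have "2 * card F + 1 = k + k * card (V - {u})" using 1 sum_vertex_degree[OF GF] by simp
      also have "\<dots> = k * card V" using u fV
        by (metis card_Suc_Diff1 mult_Suc_right)
      finally show False using ev by presburger
    qed
    then obtain v where v: "v \<in> V" "vertex_degree F v < k" "u = v \<Longrightarrow> vertex_degree F u + 2 \<le> k"
      by blast
    have "card V + 2 * k \<le> vertex_degree E u + vertex_degree E v + 2"
      using less.prems(3)[of u] less.prems(3)[of v] u v by linarith
    then obtain F' where F': "F' \<subseteq> E" "card F < card F'"
      "\<And>w. w \<in> V \<Longrightarrow> vertex_degree F w \<le> vertex_degree F' w \<and> vertex_degree F' w \<le> k"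
      using augment_deficient_pair[OF G less.prems(1) less.prems(2) u(1) v(1) u(2) v(2,3)] by blast
    have "card F' \<le> card E" using F' simple_graph_finite(2)[OF G] card_mono by blast
    show ?thesis
    proof (rule less.hyps)
      show "card E - card F' < card E - card F" using F'(2) \<open>card F' \<le> card E\<close> by linarith
      show "F' \<subseteq> E" by (rule F'(1))
      fix w assume w: "w \<in> V"
      show "vertex_degree F' w \<le> k" using F'(3)[OF w] by blast
      assume "vertex_degree F' w < k"
      then have "vertex_degree F w < k" using F'(3)[OF w] by linarith
      then show "card V + 2 * k \<le> 2 * vertex_degree E w + 2" using less.prems(3)[OF w] by blast
    qed
  qed
qed

section \<open>Saturating the vertices of low degree\<close>

text \<open>\<open>H\<close> is the set of vertices already treated. Since every edge of
  \<open>F\<close> meets \<open>H\<close>, full vertices outside \<open>L\<close> draw all their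
  \<open>k\<close> edges from \<open>H\<close>, so there are at most \<open>card H < card L\<close>
  of them. An untreated vertex has at least \<open>k + card L - 1\<close> neighbours outside
  \<open>L\<close>, hence at least \<open>k\<close> that are not full.\<close>

lemma saturate_greedily:
  assumes G: "simple_graph V E" and L: "L \<subseteq> V" and k: "k \<ge> 1"
    and "H \<subseteq> L"
    and "\<And>v. v \<in> L - H \<Longrightarrow> k + card L \<le> card (nbrs E v - L) + 1"
    and "F \<subseteq> E" "\<And>v. v \<in> V \<Longrightarrow> vertex_degree F v \<le> k"
    and "\<And>v. v \<in> H \<Longrightarrow> vertex_degree F v = k"
    and "\<And>e. e \<in> F \<Longrightarrow> e \<inter> H \<noteq> {}"
  shows "\<exists>F\<subseteq>E. (\<forall>v\<in>V. vertex_degree F v \<le> k) \<and> (\<forall>v\<in>L. vertex_degree F v = k)"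
  using assms(4-)
proof (induction "card (L - H)" arbitrary: H F)
  case 0
  have "finite L" using L simple_graph_finite(1)[OF G] finite_subset by blast
  with 0 have "L = H" by auto
  then show ?case using 0 by blast
next
  case (Suc m)
  note fV = simple_graph_finite(1)[OF G]
  note GF = simple_graph_subset[OF G Suc.prems(3)]
  note dF = vertex_degree_nbrs[OF GF]
  have fF: "finite F" using simple_graph_finite(2)[OF GF] .
  have fL: "finite L" using L fV finite_subset by blast
  have fH: "finite H" using fL Suc.prems(1) finite_subset by blast
  from Suc.hyps(2) obtain v where v: "v \<in> L" "v \<notin> H" by (metis Diff_iff card.empty equals0I nat.distinct(1))
  define S where "S = {w \<in> V - L. vertex_degree F w = k}"
  have fS: "finite S" using fV by (simp add: S_def)
  have nH: "nbrs F w \<subseteq> H" if "w \<notin> H" for w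
    using Suc.prems(6) that by (fastforce simp: nbrs_def)
  have "k * card S = (\<Sum>w\<in>S. card (nbrs F w \<inter> H))"
  proof -
    have "card (nbrs F w \<inter> H) = k" if "w \<in> S" for w
    proof -
      have "w \<notin> H" using that Suc.prems(1) by (auto simp: S_def)
      then have "nbrs F w \<inter> H = nbrs F w" using nH by blast
      then show ?thesis using that dF by (simp add: S_def)
    qed
    then show ?thesis by simp
  qed
  also have "\<dots> = (\<Sum>h\<in>H. card (nbrs F h \<inter> S))" using fS fH by (rule sum_card_nbrs_swap)
  also have "\<dots> \<le> (\<Sum>h\<in>H. k)"
  proof (rule sum_mono)
    fix h assume "h \<in> H"
    have "card (nbrs F h \<inter> S) \<le> card (nbrs F h)"
      using simple_graph_nbrs(3)[OF GF] by (simp add: card_mono)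
    then show "card (nbrs F h \<inter> S) \<le> k" using dF Suc.prems(5)[OF \<open>h \<in> H\<close>] by simp
  qed
  finally have SH: "card S \<le> card H" using k by simp
  have "card H < card L" using v Suc.prems(1) fL by (intro psubset_card_mono) auto
  have "card (nbrs E v - L) \<le> card (nbrs E v - L - S) + card S"
    using fS diff_card_le_card_Diff[OF fS, of "nbrs E v - L"] by linarith
  moreover have "k + card L \<le> card (nbrs E v - L) + 1" using Suc.prems(2) v by blast
  ultimately have "k - vertex_degree F v \<le> card (nbrs E v - L - S)"
    using SH \<open>card H < card L\<close> by linarith
  then obtain X where X: "X \<subseteq> nbrs E v - L - S" "card X = k - vertex_degree F v"
    by (meson obtain_subset_with_card_n)
  define F' where "F' = F \<union> (\<lambda>w. {v, w}) ` X"
  have XV: "X \<subseteq> V - L - S" using X simple_graph_nbrs(1)[OF G] by blast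
  have F'E: "F' \<subseteq> E" using X Suc.prems(3) by (auto simp: F'_def nbrs_def)
  note dF' = vertex_degree_nbrs[OF simple_graph_subset[OF G F'E]]
  have vV: "v \<in> V" using v L by blast
  have dv: "vertex_degree F' v = k"
  proof -
    have "nbrs F' v = nbrs F v \<union> X"
      using XV v by (auto simp: F'_def nbrs_def doubleton_eq_iff)
    moreover have "nbrs F v \<inter> X = {}" using nH[OF v(2)] XV Suc.prems(1) by blast
    moreover have "finite X" using XV fV finite_subset by blast
    ultimately have "card (nbrs F' v) = card (nbrs F v) + card X"
      using simple_graph_nbrs(3)[OF GF] by (simp add: card_Un_disjoint)
    then show ?thesis using X(2) dF[of v] dF' Suc.prems(4)[OF vV] by simp
  qed
  have dX: "vertex_degree F' w \<le> k" if "w \<in> X" for w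
  proof -
    have "nbrs F' w \<subseteq> insert v (nbrs F w)"
      using XV v that by (auto simp: F'_def nbrs_def doubleton_eq_iff)
    then have "card (nbrs F' w) \<le> card (insert v (nbrs F w))"
      using simple_graph_nbrs(3)[OF GF] by (intro card_mono) auto
    also have "\<dots> \<le> card (nbrs F w) + 1"
      using simple_graph_nbrs(3)[OF GF] by (simp add: card_insert_if)
    finally have "card (nbrs F' w) \<le> card (nbrs F w) + 1" .
    moreover have "card (nbrs F w) < k"
      using that XV Suc.prems(4)[of w] dF[of w] unfolding S_def by fastforce
    ultimately show ?thesis using dF' by simp
  qed
  have do: "vertex_degree F' w = vertex_degree F w" if "w \<notin> X" "w \<noteq> v" for w
  proof -
    have "nbrs F' w = nbrs F w" using that by (auto simp: F'_def nbrs_def doubleton_eq_iff)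
    then show ?thesis using dF dF' by simp
  qed
  show ?case
  proof (rule Suc.hyps(1)[of "insert v H" F'])
    have "L - insert v H = L - H - {v}" by blast
    then show "m = card (L - insert v H)" using Suc.hyps(2) v fL by simp
    show "insert v H \<subseteq> L" using v Suc.prems(1) by blast
    show "k + card L \<le> card (nbrs E u - L) + 1" if "u \<in> L - insert v H" for u
      using that Suc.prems(2) by blast
    show "F' \<subseteq> E" by (rule F'E)
    show "vertex_degree F' u \<le> k" if "u \<in> V" for u
      using dv dX do Suc.prems(4)[OF that] by (cases "u = v"; cases "u \<in> X") auto
    show "vertex_degree F' u = k" if "u \<in> insert v H" for u
    proof (cases "u = v")
      case False
      moreover have "u \<notin> X" using that False XV Suc.prems(1) by blast
      ultimately show ?thesis using do Suc.prems(5) that by simp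
    qed (use dv in simp)
    show "e \<inter> insert v H \<noteq> {}" if "e \<in> F'" for e
      using that Suc.prems(6) by (auto simp: F'_def)
  qed
qed

text \<open>Inject \<open>W\<close> into a set with \<open>s v\<close> slots above each
  \<open>v\<close>, then project to \<open>v\<close>.\<close>

lemma exists_fibre_bounded_map:
  assumes "finite W" "finite H" "card W \<le> (\<Sum>v\<in>H. s v)"
  obtains f :: "'a \<Rightarrow> 'b" where "f ` W \<subseteq> H" "\<And>v. v \<in> H \<Longrightarrow> card {w \<in> W. f w = v} \<le> s v"
proof -
  have "finite (Sigma H (\<lambda>v. {..<s v}))" "card W \<le> card (Sigma H (\<lambda>v. {..<s v}))"
    using assms by auto
  then obtain g where g: "g ` W \<subseteq> Sigma H (\<lambda>v. {..<s v})" "inj_on g W"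
    using card_le_inj[OF assms(1)] by blast
  show ?thesis
  proof (rule that)
    show "(fst \<circ> g) ` W \<subseteq> H" using g(1) by fastforce
    fix v assume "v \<in> H"
    have "inj_on (snd \<circ> g) {w \<in> W. (fst \<circ> g) w = v}"
      using g(2) by (auto simp: inj_on_def prod_eq_iff)
    moreover have "(snd \<circ> g) ` {w \<in> W. (fst \<circ> g) w = v} \<subseteq> {..<s v}" using g(1) by fastforce
    ultimately show "card {w \<in> W. (fst \<circ> g) w = v} \<le> s v"
      by (metis card_inj_on_le card_lessThan finite_lessThan)
  qed
qed

text \<open>An outside vertex becomes overfull only if \<open>k + 1\<close> vertices of
  \<open>H\<close> choose it. For \<open>card H = k + 1\<close>, \<open>surplus\<close> says that
  the degrees in \<open>H\<close> exceed \<open>k\<close> by at least \<open>k\<close> in total,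
  enough freedom to withhold each common neighbour from one vertex of \<open>H\<close>.\<close>

lemma saturate_small_set:
  assumes G: "simple_graph V E" and HV: "H \<subseteq> V" and h: "card H \<le> k + 1"
    and dk: "\<And>v. v \<in> H \<Longrightarrow> k \<le> vertex_degree E v"
    and surplus: "card H = k + 1 \<Longrightarrow> k * (k + 1) + k \<le> (\<Sum>v\<in>H. vertex_degree E v)"
  shows "\<exists>F\<subseteq>E. (\<forall>v\<in>V. vertex_degree F v \<le> k) \<and> (\<forall>v\<in>H. vertex_degree F v = k)
           \<and> (\<forall>e\<in>F. e \<inter> H \<noteq> {})"
proof -
  note fV = simple_graph_finite(1)[OF G]
  note dE = vertex_degree_nbrs[OF G]
  have fH: "finite H" using HV fV finite_subset by blast
  have inH: "card (nbrs E v \<inter> H) \<le> k" if "v \<in> H" for v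
  proof -
    have "nbrs E v \<inter> H \<subseteq> H - {v}" using simple_graph_nbrs(2)[OF G] by blast
    then have "card (nbrs E v \<inter> H) \<le> card (H - {v})" using fH by (meson card_mono finite_Diff)
    then show ?thesis using h that fH by simp
  qed
  have split: "vertex_degree E v = card (nbrs E v \<inter> H) + card (nbrs E v - H)" for v
    using dE simple_graph_nbrs(3)[OF G] by (metis card_Int_Diff)
  have "\<exists>C. (\<forall>v\<in>H. C v \<subseteq> nbrs E v - H \<and> card (C v) = k - card (nbrs E v \<inter> H))
      \<and> (\<forall>w. card {v \<in> H. w \<in> C v} \<le> k)"
  proof -
    \<comment> \<open>\<open>D v\<close> is the set of vertices that \<open>v\<close> may not
      choose.\<close>
    have "\<exists>D. (\<forall>v\<in>H. k - card (nbrs E v \<inter> H) \<le> card (nbrs E v - H - D v))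
      \<and> (card H = k + 1 \<longrightarrow> (\<forall>w. \<exists>v\<in>H. w \<notin> nbrs E v - H - D v))"
    proof (cases "card H = k + 1")
      case False
      have "k - card (nbrs E v \<inter> H) \<le> card (nbrs E v - H - {})" if "v \<in> H" for v
        using dk[OF that] split[of v] by simp
      with False show ?thesis by (intro exI[of _ "\<lambda>_. {}"]) blast
    next
      case True
      \<comment> \<open>Only the vertices of \<open>W\<close> could be chosen \<open>k + 1\<close> times; each is forbidden to one vertex of \<open>H\<close>,
        and no vertex of \<open>H\<close> gets more forbidden vertices than its surplus degree \<open>s\<close>.\<close>
      define W where "W = {w \<in> V - H. \<forall>v\<in>H. w \<in> nbrs E v}"
      have fW: "finite W" using fV by (simp add: W_def)
      define s where "s = (\<lambda>v. vertex_degree E v - k)"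
      have "(\<Sum>v\<in>H. s v + k) = (\<Sum>v\<in>H. vertex_degree E v)"
        using dk by (intro sum.cong) (auto simp: s_def)
      then have ks: "k \<le> (\<Sum>v\<in>H. s v)" using surplus[OF True] True by (simp add: sum.distrib algebra_simps)
      have "card W \<le> (\<Sum>v\<in>H. s v)"
      proof (cases "card W \<le> k")
        case False
        \<comment> \<open>Each \<open>v\<close> in \<open>H\<close> is adjacent to all of
          \<open>W\<close>, so its surplus is at least \<open>card W - k\<close>; summed over
          \<open>k + 1\<close> vertices this is
          \<open>k * (card W - k) + (card W - k) >= card W\<close>.\<close>
        have "card W - k \<le> s v" if "v \<in> H" for v
        proof -
          have "card W \<le> vertex_degree E v" unfolding dE
            using that simple_graph_nbrs(3)[OF G] by (intro card_mono) (auto simp: W_def)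
          then show ?thesis by (simp add: s_def)
        qed
        then have "(\<Sum>v\<in>H. card W - k) \<le> (\<Sum>v\<in>H. s v)" by (rule sum_mono)
        moreover have "(\<Sum>v\<in>H. card W - k) = k * (card W - k) + (card W - k)" using True by simp
        moreover have "k * 1 \<le> k * (card W - k)" using False by (intro mult_le_mono2) simp
        ultimately show ?thesis using False by linarith
      qed (use ks in simp)
      then obtain f where f: "f ` W \<subseteq> H" "\<And>v. v \<in> H \<Longrightarrow> card {w \<in> W. f w = v} \<le> s v"
        using exists_fibre_bounded_map[OF fW fH] by metis
      define D where "D = (\<lambda>v. {w \<in> W. f w = v})"
      \<comment> \<open>Giving up at most \<open>s v\<close> outside neighbours still leaves as many
        as \<open>v\<close> lacks, because \<open>s v\<close> is the excess of its degree over
        \<open>k\<close>.\<close>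
      have "k - card (nbrs E v \<inter> H) \<le> card (nbrs E v - H - D v)" if "v \<in> H" for v
      proof -
        have "finite (D v)" using fW by (simp add: D_def)
        then have "card (nbrs E v - H) - card (D v) \<le> card (nbrs E v - H - D v)"
          by (rule diff_card_le_card_Diff)
        moreover have "card (D v) \<le> s v" using f(2)[OF that] by (simp add: D_def)
        ultimately show ?thesis using split[of v] dk[OF that] unfolding s_def by linarith
      qed
      moreover have "\<exists>v\<in>H. w \<notin> nbrs E v - H - D v" for w
      proof (rule ccontr)
        assume "\<not> ?thesis"
        then have all: "\<And>v. v \<in> H \<Longrightarrow> w \<in> nbrs E v - H - D v" by blast
        have "H \<noteq> {}" using True by auto
        then have "w \<in> W" using all simple_graph_nbrs(1)[OF G] unfolding W_def by blast
        then have "f w \<in> H" "w \<in> D (f w)" using f(1) by (auto simp: D_def)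
        then show False using all by blast
      qed
      ultimately show ?thesis by blast
    qed
    then obtain D where D: "\<And>v. v \<in> H \<Longrightarrow> k - card (nbrs E v \<inter> H) \<le> card (nbrs E v - H - D v)"
      "card H = k + 1 \<Longrightarrow> \<forall>w. \<exists>v\<in>H. w \<notin> nbrs E v - H - D v" by blast
    have "\<forall>v\<in>H. \<exists>X. X \<subseteq> nbrs E v - H - D v \<and> card X = k - card (nbrs E v \<inter> H)"
      using D(1) by (meson obtain_subset_with_card_n)
    then obtain C where C: "\<forall>v\<in>H. C v \<subseteq> nbrs E v - H - D v \<and> card (C v) = k - card (nbrs E v \<inter> H)"
      by (auto dest: bchoice)
    have "card {v \<in> H. w \<in> C v} \<le> k" for w
    proof (cases "card H = k + 1")
      case True
      then obtain v where "v \<in> H" "w \<notin> nbrs E v - H - D v" using D(2) by blast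
      then have "{v \<in> H. w \<in> C v} \<subset> H" using C by blast
      then have "card {v \<in> H. w \<in> C v} < card H" using fH psubset_card_mono by blast
      then show ?thesis using True by simp
    next
      case False
      have "card {v \<in> H. w \<in> C v} \<le> card H" using fH by (simp add: card_mono)
      then show ?thesis using h False by simp
    qed
    then show ?thesis using C by (intro exI[of _ C]) blast
  qed
  then obtain C where C: "\<And>v. v \<in> H \<Longrightarrow> C v \<subseteq> nbrs E v - H"
      "\<And>v. v \<in> H \<Longrightarrow> card (C v) = k - card (nbrs E v \<inter> H)"
      "\<And>w. card {v \<in> H. w \<in> C v} \<le> k" by blast
  define F where "F = {e \<in> E. \<exists>v\<in>H. \<exists>w\<in>H \<union> C v. e = {v, w}}"
  have FE: "F \<subseteq> E" by (auto simp: F_def)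
  note dF = vertex_degree_nbrs[OF simple_graph_subset[OF G FE]]
  have deg: "vertex_degree F v = k" if v: "v \<in> H" for v
  proof -
    \<comment> \<open>Choices made by other vertices of \<open>H\<close> end outside
      \<open>H\<close>, so they add no neighbour to \<open>v\<close>.\<close>
    have "nbrs F v = (nbrs E v \<inter> H) \<union> C v"
    proof
      show "nbrs F v \<subseteq> (nbrs E v \<inter> H) \<union> C v"
        using v C(1) by (fastforce simp: F_def nbrs_def doubleton_eq_iff)
      show "(nbrs E v \<inter> H) \<union> C v \<subseteq> nbrs F v"
        using v C(1)[OF v] by (auto simp: F_def nbrs_def)
    qed
    moreover have "(nbrs E v \<inter> H) \<inter> C v = {}" using C(1)[OF v] by blast
    moreover have "finite (C v)" using C(1)[OF v] simple_graph_nbrs(3)[OF G] finite_subset by blast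
    ultimately have "card (nbrs F v) = card (nbrs E v \<inter> H) + card (C v)"
      using fH by (simp add: card_Un_disjoint)
    then show ?thesis using dF C(2)[OF v] inH[OF v] by simp
  qed
  have deg': "vertex_degree F w \<le> k" if w: "w \<notin> H" for w
  proof -
    have "nbrs F w \<subseteq> {v \<in> H. w \<in> C v}"
      using w by (auto simp: F_def nbrs_def doubleton_eq_iff)
    then have "card (nbrs F w) \<le> card {v \<in> H. w \<in> C v}" using fH by (intro card_mono) auto
    then show ?thesis using C(3)[of w] dF by simp
  qed
  have "vertex_degree F v \<le> k" for v using deg deg' by (cases "v \<in> H") auto
  moreover have "\<forall>e\<in>F. e \<inter> H \<noteq> {}" by (auto simp: F_def)
  ultimately show ?thesis using FE deg by blast
qed

section \<open>Consequences of the edge bound\<close>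

lemma twice_choose_two: "2 * int (m choose 2) = int m * (int m - 1)"
proof -
  have "even (m * (m - 1))" by auto
  then have "2 * (m choose 2) = m * (m - 1)" by (simp add: choose_two)
  then have "2 * int (m choose 2) = int (m * (m - 1))" by (metis of_nat_mult of_nat_numeral)
  then show ?thesis by (cases m) (simp_all add: algebra_simps)
qed

text \<open>Too many vertices of degree about \<open>n / 2\<close> cost too many edges. This cap on
  \<open>card L\<close> keeps the finer count in \<open>card_hard_le\<close> under control.\<close>

lemma card_low_degree_le:
  fixes k :: nat
  assumes G: "simple_graph V E" and n: "n = int (card V)"
    and k: "k \<ge> 2" and n13: "n \<ge> 13 * int k ^ 2 - 11 * int k - 1"
    and e: "2 * int (card E) \<ge> (n - k - 1) * (n - k - 2) + 2 * int k ^ 2 + 4 * int k"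
    and L: "L \<subseteq> V" and low: "\<And>v. v \<in> L \<Longrightarrow> 2 * int (vertex_degree E v) \<le> n + 2 * int k - 3"
  shows "card L \<le> 2 * k + 3"
proof (rule ccontr)
  assume "\<not> ?thesis"
  \<comment> \<open>A set of \<open>t\<close> such vertices bounds
    \<open>(t - 2 * k - 2) * n\<close> by a quadratic in \<open>t\<close> and \<open>k\<close>. Here
    \<open>t = 2 * k + 4\<close> yields \<open>2 * n <= 5 * k^2 + 13 * k + 6\<close>; one vertex
    fewer would yield \<open>n <= 5 * k^2 + 7 * k + 1\<close>, which need not contradict
    \<open>n13\<close> when \<open>k = 2\<close>.\<close>
  then obtain T where T: "T \<subseteq> L" "card T = 2 * k + 4"
    using obtain_subset_with_card_n[of "2 * k + 4" L] by auto
  have TV: "T \<subseteq> V" using T L by blast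
  define q where "q = int k"
  have "int (vertex_degree E v) + int (card (nbrs E v - T)) \<le> n + 2 * q - 3" if "v \<in> T" for v
  proof -
    have "card (nbrs E v - T) \<le> vertex_degree E v"
      using vertex_degree_nbrs[OF G] simple_graph_nbrs(3)[OF G] by (simp add: card_mono)
    then show ?thesis using low[of v] T that unfolding q_def by auto
  qed
  then have "(\<Sum>v\<in>T. int (vertex_degree E v) + int (card (nbrs E v - T))) \<le> (\<Sum>v\<in>T. n + 2 * q - 3)"
    by (rule sum_mono)
  also have "\<dots> = (2 * q + 4) * (n + 2 * q - 3)" using T(2) by (simp add: q_def)
  finally have "2 * int (card E) \<le> (n - (2 * q + 4)) * (n - (2 * q + 4) - 1) + (2 * q + 4) * (n + 2 * q - 3)"
    using twice_card_edges_le[OF G TV] T n by (simp add: q_def)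
  then have "2 * n \<le> 5 * q^2 + 13 * q + 6"
    using e unfolding q_def[symmetric] by (simp add: algebra_simps power2_eq_square)
  moreover have "2 \<le> q" using k by (simp add: q_def)
  moreover from this have "2 * q \<le> q * q" by (intro mult_right_mono) auto
  ultimately show False using n13 unfolding q_def[symmetric] power2_eq_square by linarith
qed

text \<open>
  A bound using \<open>H\<close> alone is too weak for \<open>k = 2\<close>: the \<open>j\<close> further vertices of \<open>L\<close> have to be
  counted with their degrees of about \<open>n / 2\<close>.
\<close>
lemma card_hard_le:
  fixes k :: nat
  assumes G: "simple_graph V E" and n: "n = int (card V)"
    and k: "k \<ge> 2" and n13: "n \<ge> 13 * int k ^ 2 - 11 * int k - 1"
    and e: "2 * int (card E) \<ge> (n - k - 1) * (n - k - 2) + 2 * int k ^ 2 + 4 * int k"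
    and L: "L \<subseteq> V" and low: "\<And>v. v \<in> L \<Longrightarrow> 2 * int (vertex_degree E v) \<le> n + 2 * int k - 3"
    and H: "H \<subseteq> L" and hard: "\<And>v. v \<in> H \<Longrightarrow> card (nbrs E v - L) + 1 < k + card L"
  shows "card H \<le> k + 1"
proof (rule ccontr)
  assume "\<not> ?thesis"
  then obtain T where T: "T \<subseteq> H" "card T = k + 2"
    using obtain_subset_with_card_n[of "k + 2" H] by auto
  have fL: "finite L" using L simple_graph_finite(1)[OF G] finite_subset by blast
  have fT: "finite T" using T H fL by (meson finite_subset)
  have TL: "T \<subseteq> L" using T H by blast
  \<comment> \<open>\<open>j\<close> is the number of vertices of \<open>L\<close> outside
    \<open>T\<close>.\<close>
  define q j where "q = int k" and "j = int (card L) - q - 2"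
  have l: "int (card L) = q + 2 + j" by (simp add: j_def)
  have TcL: "card T \<le> card L" using TL fL card_mono by blast
  then have j0: "0 \<le> j" using T(2) by (simp add: j_def q_def)
  have "int (card (L - T)) = j"
    using TcL T(2) card_Diff_subset[OF fT TL] by (simp add: j_def q_def)
  then have LT: "(\<Sum>v\<in>L - T. n + 2 * q - 3) = j * (n + 2 * q - 3)" by simp
  have "card L \<le> 2 * k + 3" using card_low_degree_le[OF G n k n13 e L low] .
  then have j1: "j \<le> q + 1" by (simp add: j_def q_def)
  have dle: "card (nbrs E v - L) \<le> vertex_degree E v" for v
    using vertex_degree_nbrs[OF G] simple_graph_nbrs(3)[OF G] by (simp add: card_mono)
  have "int (vertex_degree E v) + int (card (nbrs E v - L)) \<le> n + 2 * q - 3" if "v \<in> L - T" for v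
    using low[of v] dle[of v] that unfolding q_def by auto
  then have s1: "(\<Sum>v\<in>L - T. int (vertex_degree E v) + int (card (nbrs E v - L))) \<le> (\<Sum>v\<in>L - T. n + 2 * q - 3)"
    by (rule sum_mono)
  \<comment> \<open>A vertex of \<open>T\<close> has at most \<open>card L - 1\<close> neighbours
    inside \<open>L\<close> and, by \<open>hard\<close>, at most \<open>k + card L - 2\<close>
    outside, so its degree is at most \<open>k + 2 * card L - 3\<close>; the second summand is
    bounded by the same number.\<close>
  have "int (vertex_degree E v) + int (card (nbrs E v - L)) \<le> 2 * (3 * q + 1 + 2 * j)" if "v \<in> T" for v
  proof -
    have "nbrs E v \<inter> L \<subseteq> L - {v}" using simple_graph_nbrs(2)[OF G] by blast
    then have "card (nbrs E v \<inter> L) \<le> card (L - {v})" using fL by (meson card_mono finite_Diff)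
    then have "card (nbrs E v \<inter> L) + 1 \<le> card L"
      using that TL fL by (metis Suc_eq_plus1 card_Suc_Diff1 not_less_eq_eq subsetD Suc_le_mono)
    moreover have "vertex_degree E v = card (nbrs E v \<inter> L) + card (nbrs E v - L)"
      using vertex_degree_nbrs[OF G] simple_graph_nbrs(3)[OF G] by (metis card_Int_Diff)
    moreover have "card (nbrs E v - L) + 1 < k + card L" using hard that T by blast
    ultimately have "vertex_degree E v + card (nbrs E v - L) + 6 \<le> 2 * (k + 2 * card L)" by presburger
    then have "int (vertex_degree E v) + int (card (nbrs E v - L)) + 6 \<le> 2 * (q + 2 * int (card L))"
      unfolding q_def by presburger
    then show ?thesis using l by simp
  qed
  then have "(\<Sum>v\<in>T. int (vertex_degree E v) + int (card (nbrs E v - L))) \<le> (\<Sum>v\<in>T. 2 * (3 * q + 1 + 2 * j))"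
    by (rule sum_mono)
  also have "\<dots> = (q + 2) * (2 * (3 * q + 1 + 2 * j))" using T(2) by (simp add: q_def)
  finally have "(\<Sum>v\<in>L. int (vertex_degree E v) + int (card (nbrs E v - L)))
      \<le> (q + 2) * (2 * (3 * q + 1 + 2 * j)) + (\<Sum>v\<in>L - T. n + 2 * q - 3)"
    using s1 sum.subset_diff[OF TL fL, of "\<lambda>v. int (vertex_degree E v) + int (card (nbrs E v - L))"]
    by linarith
  also note LT
  finally have "2 * int (card E) \<le> (n - (q + 2 + j)) * (n - (q + 2 + j) - 1)
      + ((q + 2) * (2 * (3 * q + 1 + 2 * j)) + j * (n + 2 * q - 3))"
    using twice_card_edges_le[OF G L] n l by simp
  then have main: "2 * (n - 2 * q^2 - 6 * q - 4) + j * (n - 8 * q - 10 - j) \<le> 0"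
    using e unfolding q_def[symmetric] by (simp add: algebra_simps power2_eq_square)
  have q2: "2 \<le> q" using k by (simp add: q_def)
  then have qq: "2 * q \<le> q * q" by (intro mult_right_mono) auto
  \<comment> \<open>The cap \<open>j <= q + 1\<close> is just enough: the resulting lower bound
    \<open>n - 9 * q - 11\<close> is zero for \<open>k = 2\<close> and
    \<open>n = 29\<close>.\<close>
  have "0 \<le> n - 8 * q - 10 - j" using n13 qq q2 j1 unfolding q_def[symmetric] power2_eq_square by linarith
  then have "0 \<le> j * (n - 8 * q - 10 - j)" using j0 by simp
  moreover have "0 < n - 2 * q^2 - 6 * q - 4" using n13 qq q2 unfolding q_def[symmetric] power2_eq_square by linarith
  ultimately show False using main by (simp add: algebra_simps)
qed

text \<open>The case \<open>k = 1\<close>, \<open>n = 4\<close>: two vertices of degree at most 1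
  leave room for only three edges.\<close>

lemma card_leaves_le_one:
  assumes G: "simple_graph V E" and "card V = 4" "card E \<ge> 4"
    and L: "L \<subseteq> V" and low: "\<And>v. v \<in> L \<Longrightarrow> vertex_degree E v \<le> 1"
  shows "card L \<le> 1"
proof (rule ccontr)
  assume "\<not> ?thesis"
  then obtain T where T: "T \<subseteq> L" "card T = 2"
    using obtain_subset_with_card_n[of 2 L] by auto
  have TV: "T \<subseteq> V" using T L by blast
  have "int (vertex_degree E v) + int (card (nbrs E v - T)) \<le> 2" if "v \<in> T" for v
  proof -
    have "card (nbrs E v - T) \<le> vertex_degree E v"
      using vertex_degree_nbrs[OF G] simple_graph_nbrs(3)[OF G] by (simp add: card_mono)
    moreover have "vertex_degree E v \<le> 1" using low T that by blast
    ultimately show ?thesis by linarith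
  qed
  then have "(\<Sum>v\<in>T. int (vertex_degree E v) + int (card (nbrs E v - T))) \<le> (\<Sum>v\<in>T. 2)"
    by (rule sum_mono)
  then show False using twice_card_edges_le[OF G TV] T assms(2,3) by simp
qed

text \<open>Counterpart of \<open>card_hard_le\<close> for \<open>k = 1\<close>, where the margins
  are narrow: five vertices in \<open>L\<close> would give \<open>n <= 8\<close>, and
  \<open>card L = 3\<close> with all of \<open>L\<close> hard would give
  \<open>n <= 9\<close>.\<close>

lemma card_hard_le_two:
  assumes G: "simple_graph V E" and n: "n = int (card V)" and n10: "n \<ge> 10"
    and e: "2 * int (card E) \<ge> (n - 2) * (n - 3) + 6"
    and L: "L \<subseteq> V" and low: "\<And>v. v \<in> L \<Longrightarrow> 2 * int (vertex_degree E v) \<le> n - 2"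
    and H: "H \<subseteq> L" and hard: "\<And>v. v \<in> H \<Longrightarrow> card (nbrs E v - L) < card L"
  shows "card H \<le> 2"
proof (rule ccontr)
  assume H3: "\<not> ?thesis"
  have fL: "finite L" using L simple_graph_finite(1)[OF G] finite_subset by blast
  have dle: "card (nbrs E v - T) \<le> vertex_degree E v" for v T
    using vertex_degree_nbrs[OF G] simple_graph_nbrs(3)[OF G] by (simp add: card_mono)
  have "card L \<le> 4"
  proof (rule ccontr)
    assume "\<not> ?thesis"
    then obtain T where T: "T \<subseteq> L" "card T = 5"
      using obtain_subset_with_card_n[of 5 L] by auto
    have TV: "T \<subseteq> V" using T L by blast
    have "int (vertex_degree E v) + int (card (nbrs E v - T)) \<le> n - 2" if "v \<in> T" for v
      using low[of v] T that dle[where v = v and T = T] by auto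
    then have "(\<Sum>v\<in>T. int (vertex_degree E v) + int (card (nbrs E v - T))) \<le> (\<Sum>v\<in>T. n - 2)"
      by (rule sum_mono)
    then have "2 * int (card E) \<le> (n - 5) * (n - 6) + 5 * (n - 2)"
      using twice_card_edges_le[OF G TV] T n by simp
    then show False using e n10 by (simp add: algebra_simps)
  qed
  moreover have "card H \<le> card L" using H fL card_mono by blast
  ultimately consider "card L = 3" | "card L = 4" using H3 by linarith
  then show False
  proof cases
    case 1
    then have "H = L" using H3 by (intro card_seteq[OF fL H]) linarith
    have "int (vertex_degree E v) + int (card (nbrs E v - L)) \<le> 6" if "v \<in> L" for v
    proof -
      have "nbrs E v \<inter> L \<subseteq> L - {v}" using simple_graph_nbrs(2)[OF G] by blast
      then have "card (nbrs E v \<inter> L) \<le> card (L - {v})" using fL by (meson card_mono finite_Diff)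
      then have "card (nbrs E v \<inter> L) \<le> 2" using that fL 1 by simp
      moreover have "vertex_degree E v = card (nbrs E v \<inter> L) + card (nbrs E v - L)"
        using vertex_degree_nbrs[OF G] simple_graph_nbrs(3)[OF G] by (metis card_Int_Diff)
      moreover have "card (nbrs E v - L) < 3" using hard that 1 \<open>H = L\<close> by auto
      ultimately show ?thesis by linarith
    qed
    then have "(\<Sum>v\<in>L. int (vertex_degree E v) + int (card (nbrs E v - L))) \<le> (\<Sum>v\<in>L. 6)"
      by (rule sum_mono)
    then have "2 * int (card E) \<le> (n - 3) * (n - 4) + 18"
      using twice_card_edges_le[OF G L] n 1 by simp
    then show False using e n10 by (simp add: algebra_simps)
  next
    case 2
    \<comment> \<open>For \<open>card L = 4\<close> the plain count exactly meets the edge bound, so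
      strictness is needed; a hard vertex, with fewer than 4 neighbours outside \<open>L\<close>,
      provides it.\<close>
    have "(\<Sum>v\<in>L. int (vertex_degree E v) + int (card (nbrs E v - L))) < (\<Sum>v\<in>L. n - 2)"
    proof (rule sum_strict_mono_ex1[OF fL])
      show "\<forall>v\<in>L. int (vertex_degree E v) + int (card (nbrs E v - L)) \<le> n - 2"
      proof
        fix v assume "v \<in> L"
        then show "int (vertex_degree E v) + int (card (nbrs E v - L)) \<le> n - 2"
          using low[of v] dle[of v L] by linarith
      qed
      have "H \<noteq> {}" using H3 by auto
      then obtain v where v: "v \<in> H" by blast
      then have "card (nbrs E v - L) < 4" using hard 2 by simp
      then have "int (vertex_degree E v) + int (card (nbrs E v - L)) < n - 2"
        using low[of v] v H n10 by auto
      then show "\<exists>v\<in>L. int (vertex_degree E v) + int (card (nbrs E v - L)) < n - 2"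
        using v H by blast
    qed
    also have "\<dots> = 4 * (n - 2)" using 2 by simp
    finally have "2 * int (card E) < (n - 4) * (n - 5) + 4 * (n - 2)"
      using twice_card_edges_le[OF G L] n 2 by simp
    then show False using e by (simp add: algebra_simps)
  qed
qed

section \<open>Assembling the k-factor\<close>

text \<open>Two hypotheses go beyond the informal statement, which fails without them. A k-factor
  has degree sum \<open>k * n\<close>, so this must be even. For \<open>k = 1\<close>, joining two
  adjacent vertices to four independent ones (\<open>n = 6\<close>, 9 edges), or a triangle to five
  independent ones (\<open>n = 8\<close>, 18 edges), satisfies the other hypotheses but has no
  perfect matching.\<close>

theorem theorem3:
  fixes V :: "'a set" and E :: "'a set set" and k n :: nat
  assumes "k \<ge> 1"
    and "simple_graph V E"
    and "connected_graph V E"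
    and "card V = n"
    and "int n \<ge> 13 * int k ^ 2 - 11 * int k - 1"
    and "min_degree V E \<ge> k"
    and "card E > ((n - k - 1) choose 2) + k * (k + 1) + k - 1"
    and "even (k * n)"
    and "\<not> (k = 1 \<and> n \<in> {6, 8})"
  shows "\<exists>F. is_k_factor k V E F"
proof -
  note G = assms(2)
  note fV = simple_graph_finite(1)[OF G]
  note dE = vertex_degree_nbrs[OF G]
  have dk: "k \<le> vertex_degree E v" if "v \<in> V" for v
    using assms(6) fV that unfolding min_degree_def
    by (meson Min_le finite_imageI imageI le_trans)
  have "V \<noteq> {}" using assms(3) by (simp add: connected_graph_def)
  then obtain v0 where v0: "v0 \<in> V" by blast
  have "card (nbrs E v0) \<le> card (V - {v0})"
    using simple_graph_nbrs[OF G, of v0] fV by (intro card_mono) auto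
  \<comment> \<open>Ensures that the truncated \<open>n - k - 1\<close> is the true
    difference.\<close>
  then have kn: "k + 1 \<le> n"
    using dk[OF v0] dE v0 fV assms(4) card_Suc_Diff1[OF fV v0] by simp
  have e: "2 * int (card E) \<ge> (int n - k - 1) * (int n - k - 2) + 2 * int k ^ 2 + 4 * int k"
  proof -
    have "card E \<ge> ((n - k - 1) choose 2) + k * (k + 1) + k" using assms(1,7) by linarith
    then have "int (card E) \<ge> int (((n - k - 1) choose 2) + k * (k + 1) + k)" by (rule of_nat_mono)
    then have "int (card E) \<ge> int ((n - k - 1) choose 2) + int k * (int k + 1) + int k"
      by (simp only: of_nat_add of_nat_mult of_nat_1)
    then have "2 * int (card E) \<ge> int (n - k - 1) * (int (n - k - 1) - 1) + 2 * (int k * (int k + 1) + int k)"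
      using twice_choose_two[of "n - k - 1"] by (simp add: algebra_simps)
    moreover have "int (n - k - 1) = int n - k - 1" using kn by simp
    ultimately show ?thesis by (simp add: algebra_simps power2_eq_square)
  qed
  \<comment> \<open>\<open>L\<close> collects the vertices violating the degree condition of
    \<open>k_factor_completion\<close>, \<open>H\<close> those of \<open>L\<close> violating the one
    of \<open>saturate_greedily\<close>.\<close>
  define L where "L = {v \<in> V. 2 * vertex_degree E v + 2 < n + 2 * k}"
  define H where "H = {v \<in> L. card (nbrs E v - L) + 1 < k + card L}"
  have LV: "L \<subseteq> V" and HL: "H \<subseteq> L" by (auto simp: L_def H_def)
  have low: "2 * int (vertex_degree E v) \<le> int n + 2 * int k - 3" if "v \<in> L" for v
    using that by (simp add: L_def)
  have hH: "card H \<le> k + 1"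
  proof (cases "k = 1")
    case False
    then have "k \<ge> 2" using assms(1) by simp
    then show ?thesis
      using card_hard_le[OF G _ _ assms(5) e LV low HL] assms(4) by (simp add: H_def)
  next
    case True
    have "even n" using assms(8) True by simp
    \<comment> \<open>\<open>low\<close> gives \<open>n - 1\<close>, which is odd, so parity gains
      one more.\<close>
    have low1: "2 * int (vertex_degree E v) \<le> int n - 2" if "v \<in> L" for v
      using low[OF that] True \<open>even n\<close> by presburger
    have e1: "2 * int (card E) \<ge> (int n - 2) * (int n - 3) + 6" using e True by simp
    have "n \<noteq> 2"
    proof
      assume "n = 2"
      then have "2 * int (card E) \<le> 2" using twice_card_edges_le[OF G, of "{}"] assms(4) by simp
      then show False using e1 \<open>n = 2\<close> by simp
    qed
    moreover have "n \<noteq> 6" "n \<noteq> 8" "2 \<le> n" using kn True assms(9) by auto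
    ultimately have "n = 4 \<or> n \<ge> 10" using \<open>even n\<close> by presburger
    then consider "n = 4" | "n \<ge> 10" by blast
    then show ?thesis
    proof cases
      case 1
      have "vertex_degree E v \<le> 1" if "v \<in> L" for v using low1[OF that] 1 by simp
      then have "card L \<le> 1" using card_leaves_le_one[OF G _ _ LV] assms(4) e1 1 by simp
      moreover have "card H \<le> card L" using HL LV fV by (meson card_mono finite_subset)
      ultimately show ?thesis by simp
    next
      case 2
      then show ?thesis using card_hard_le_two[OF G _ _ e1 LV low1 HL] assms(4) True by (simp add: H_def)
    qed
  qed
  have HV: "H \<subseteq> V" using HL LV by blast
  \<comment> \<open>For \<open>T = H\<close> the term \<open>(n - k - 1) * (n - k - 2)\<close> is
    exactly the leading part of the edge bound; the remaining \<open>2 * k^2 + 4 * k\<close> bounds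
    twice the degree sum over \<open>H\<close> from below.\<close>
  have surplus: "k * (k + 1) + k \<le> (\<Sum>v\<in>H. vertex_degree E v)" if "card H = k + 1"
  proof -
    have "(\<Sum>v\<in>H. int (vertex_degree E v) + int (card (nbrs E v - H))) \<le> (\<Sum>v\<in>H. 2 * int (vertex_degree E v))"
      using dE simple_graph_nbrs(3)[OF G] by (intro sum_mono) (simp add: card_mono)
    also have "\<dots> = 2 * int (\<Sum>v\<in>H. vertex_degree E v)" by (simp add: sum_distrib_left)
    finally have "2 * int (card E) \<le> (int n - k - 1) * (int n - k - 2) + 2 * int (\<Sum>v\<in>H. vertex_degree E v)"
      using twice_card_edges_le[OF G HV] that assms(4) by (simp add: algebra_simps)
    then have "int (k * (k + 1) + k) \<le> int (\<Sum>v\<in>H. vertex_degree E v)"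
      using e by (simp add: algebra_simps power2_eq_square)
    then show ?thesis by linarith
  qed
  have "\<exists>F\<subseteq>E. (\<forall>v\<in>V. vertex_degree F v \<le> k) \<and> (\<forall>v\<in>H. vertex_degree F v = k)
      \<and> (\<forall>e\<in>F. e \<inter> H \<noteq> {})"
  proof (rule saturate_small_set[OF G HV hH])
    show "k \<le> vertex_degree E v" if "v \<in> H" for v using dk HV that by blast
  qed (rule surplus)
  then obtain F0 where F0: "F0 \<subseteq> E" "\<forall>v\<in>V. vertex_degree F0 v \<le> k"
    "\<forall>v\<in>H. vertex_degree F0 v = k" "\<forall>e\<in>F0. e \<inter> H \<noteq> {}"
    by blast
  have "\<exists>F\<subseteq>E. (\<forall>v\<in>V. vertex_degree F v \<le> k) \<and> (\<forall>v\<in>L. vertex_degree F v = k)"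
  proof (rule saturate_greedily[OF G LV assms(1) HL _ F0(1)])
    show "k + card L \<le> card (nbrs E v - L) + 1" if "v \<in> L - H" for v
      using that by (auto simp: H_def)
  qed (use F0 in blast)+
  then obtain F where F: "F \<subseteq> E" "\<And>v. v \<in> V \<Longrightarrow> vertex_degree F v \<le> k"
    "\<And>v. v \<in> L \<Longrightarrow> vertex_degree F v = k"
    by blast
  show ?thesis
  proof (rule k_factor_completion[OF G _ F(1,2)])
    show "even (k * card V)" using assms(4,8) by simp
    fix v assume "v \<in> V" "vertex_degree F v < k"
    then have "v \<notin> L" using F(3)[of v] by auto
    then show "card V + 2 * k \<le> 2 * vertex_degree E v + 2"
      using \<open>v \<in> V\<close> assms(4) by (simp add: L_def)
  qed
qed

end
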